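(* Let $n\ge5$ be odd. Then $$n(n-1)\,y^2F_{n-2}(y)=\tfrac12\,\theta_{y,\frac12}\theta_y\bigl(F_n(y)-F_n(0)\bigr)+6y\,\theta_{y,\frac12}\theta_{y,\frac23}F_n(y).$$ Equivalently, for all $k\ge0$, $$\binom{n}{2}\,\mathfrak{f}_{n-2,k}=\frac12\binom{2(k+3)}{2}\,\mathfrak{f}_{n,k+1}+\frac14\binom{k+4}{2}\,\mathfrak{f}_{n,k+2}.$$ In particular, for every odd $n\ge3$ the leading coefficient of $F_n$ is $$\mathfrak{f}_{n,\mathbf{d}_n}=\frac{2^{(n+1)/2}}{n+1}.$$
   Context: Bernoulli polynomials: $\frac{te^{xt}}{e^t-1}=\sum_{n\ge0}\mathbf{B}_n(x)\frac{t^n}{n!}$, and $\mathbf{B}_n=\mathbf{B}_n(0)$. Power sums: $S_n(x)=\frac{1}{n+1}(\mathbf{B}_{n+1}(x)-\mathbf{B}_{n+1})$ for $n\ge0$, so that $S_n(m)=\sum_{\nu=0}^{m-1}\nu^n$; in particular $S_1(x)=\binom{x}{2}$. Faulhaber polynomials (classical Faulhaber–Jacobi theorem): for each $n\ge2$ there is a unique polynomial $F_n\in\mathbb{Q}[y]$, of degree $\mathbf{d}_n=\lfloor n/2\rfloor-1$, such that $S_n(x)=S_2(x)\,F_n(S_1(x))$ if $n$ is even and $S_n(x)=S_1(x)^2\,F_n(S_1(x))$ if $n$ is odd. Its coefficients are denoted $F_n(y)=\sum_{k\ge0}\mathfrak{f}_{n,k}\,y^k$, with $\mathfrak{f}_{n,k}=0$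 for $k>\mathbf{d}_n$. Differential operators: $\theta_{y,\alpha}=1+\alpha\,y\,\frac{d}{dy}$ and $\theta_y=\theta_{y,1}$; products of operators denote composition. *)

theory Defs
  imports "HOL-Computational_Algebra.Computational_Algebra"
begin

(* The series t e^(xt) / (e^t - 1) as a power series in t over the polynomial ring in x.
   The quotient t / (e^t - 1) is formed over the rationals, where both series are
   divisible by t and the cancelled denominator is a unit, and its coefficients are
   then embedded as constant polynomials. *)

definition bernoulli_gf :: "rat poly fps" where
  "bernoulli_gf =
     Abs_fps (\<lambda>n. [:fps_nth (fps_X / (fps_exp (1::rat) - 1)) n:])
     * Abs_fps (\<lambda>n. monom (1 / fact n) n)"

definition bernoulli_poly :: "nat \<Rightarrow> rat poly" where
  "bernoulli_poly n = smult (fact n) (fps_nth bernoulli_gf n)"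

definition bernoulli_num :: "nat \<Rightarrow> rat" where
  "bernoulli_num n = poly (bernoulli_poly n) 0"

definition power_sum :: "nat \<Rightarrow> rat poly" where
  "power_sum n =
     smult (1 / of_nat (n + 1)) (bernoulli_poly (n + 1) - [:bernoulli_num (n + 1):])"

definition faulhaber_degree :: "nat \<Rightarrow> nat" where
  "faulhaber_degree n = n div 2 - 1"

(* Only meaningful for n >= 2; existence and uniqueness are the Faulhaber-Jacobi theorem. *)

definition faulhaber :: "nat \<Rightarrow> rat poly" where
  "faulhaber n = (THE F. degree F = faulhaber_degree n \<and>
     (if even n then power_sum n = power_sum 2 * (F \<circ>\<^sub>p power_sum 1)
      else power_sum n = (power_sum 1)\<^sup>2 * (F \<circ>\<^sub>p power_sum 1)))"

abbreviation faulhaber_coeff :: "nat \<Rightarrow> nat \<Rightarrow> rat" where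
  "faulhaber_coeff n k \<equiv> coeff (faulhaber n) k"

abbreviation polyvar :: "rat poly" where
  "polyvar \<equiv> [:0, 1:]"

definition theta :: "rat \<Rightarrow> rat poly \<Rightarrow> rat poly" where
  "theta \<alpha> p = p + smult \<alpha> (polyvar * pderiv p)"

end

theory Submission
  imports Defs
begin

text \<open>
  Put \<open>y = S\<^sub>1(x)\<close> and \<open>L G = (2 y + 1/4) G'' + G'\<close>, so that the second \<open>x\<close>-derivative of \<open>G(y)\<close>
  is \<open>(L G)(y)\<close>. Since \<open>S\<^sub>n'' = n (n - 1) S\<^sub>n\<^sub>-\<^sub>2 + const\<close>, since \<open>L\<close> is onto, and since a polynomial is
  determined by its second derivative and its values at \<open>0\<close> and \<open>1\<close>, induction shows that
  for odd \<open>n\<close> the power sum \<open>S\<^sub>n\<close> is a polynomial \<open>G\<close> in \<open>y\<close>; for \<open>n \<ge> 3\<close> it is divisible by \<open>y\<^sup>2\<close>.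
  With \<open>G = y\<^sup>2 F\<^sub>n\<close>, the claims are the coefficients of \<open>L G = n (n - 1) y\<^sup>2 F\<^sub>n\<^sub>-\<^sub>2 + const\<close> at
  \<open>y\<close> and at \<open>y\<^sup>k\<^sup>+\<^sup>2\<close>, together with a comparison of the leading coefficients of \<open>S\<^sub>n\<close> and \<open>G(y)\<close>.
\<close>

section \<open>Bernoulli numbers and polynomials\<close>

abbreviation bern_fps :: "rat fps" where
  "bern_fps \<equiv> fps_X / (fps_exp 1 - 1)"

text \<open>The divisor has subdegree 1, so it divides \<open>fps_X\<close> and the quotient is
  exact.\<close>

lemma bern_fps_mult: "bern_fps * (fps_exp 1 - 1) = fps_X"
proof (rule dvd_div_mult_self)
  have "fps_nth (fps_exp 1 - 1 :: rat fps) (Suc 0) = 1" by simp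
  then have nz: "fps_exp 1 - 1 \<noteq> (0 :: rat fps)" by (metis fps_zero_nth zero_neq_one)
  have "subdegree (fps_exp 1 - 1 :: rat fps) = 1"
    by (rule subdegreeI) auto
  then show "fps_exp 1 - 1 dvd (fps_X :: rat fps)"
    using nz by (simp add: fps_dvd_iff)
qed

lemma bern_fps_nth_0: "fps_nth bern_fps 0 = 1"
  using arg_cong[OF bern_fps_mult, of "\<lambda>f. fps_nth f 1"]
  by (simp add: fps_mult_nth)

lemma bern_fps_nth_1: "fps_nth bern_fps (Suc 0) = - 1 / 2"
  using arg_cong[OF bern_fps_mult, of "\<lambda>f. fps_nth f 2"] bern_fps_nth_0
  by (simp add: fps_mult_nth numeral_2_eq_2)

text \<open>In the Cauchy product only the term i = n - j contributes to x^j. The later facts on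
  Bernoulli polynomials are read off from this closed form.\<close>

lemma coeff_bernoulli_poly:
  "coeff (bernoulli_poly n) j =
     (if j \<le> n then fact n * fps_nth bern_fps (n - j) / fact j else 0)"
proof -
  have "coeff (fps_nth bernoulli_gf n) j =
      (\<Sum>i=0..n. fps_nth bern_fps i * (if n - i = j then 1 / fact (n - i) else 0))"
    unfolding bernoulli_gf_def fps_mult_nth by (simp add: coeff_sum)
  also have "\<dots> = (\<Sum>i=0..n. if i = n - j \<and> j \<le> n then fps_nth bern_fps i / fact j else 0)"
    by (intro sum.cong) auto
  also have "\<dots> = (if j \<le> n then fps_nth bern_fps (n - j) / fact j else 0)"
    by (cases "j \<le> n") auto
  finally show ?thesis
    unfolding bernoulli_poly_def by simp
qed

lemma degree_bernoulli_poly: "degree (bernoulli_poly n) = n"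
  and lead_coeff_bernoulli_poly: "coeff (bernoulli_poly n) n = 1"
proof -
  show "coeff (bernoulli_poly n) n = 1"
    by (simp add: coeff_bernoulli_poly bern_fps_nth_0)
  then show "degree (bernoulli_poly n) = n"
    by (intro antisym degree_le le_degree) (auto simp: coeff_bernoulli_poly)
qed

lemma pderiv_bernoulli_poly:
  "pderiv (bernoulli_poly (Suc n)) = smult (of_nat (Suc n)) (bernoulli_poly n)"
  by (rule poly_eqI)
    (auto simp: coeff_pderiv coeff_bernoulli_poly field_simps simp del: of_nat_Suc)

text \<open>Setting x = 1 multiplies the series B of \<open>bern_fps\<close> by e^t, and B e^t = B +
  t, so only the coefficient of t changes.\<close>

lemma poly_bernoulli_poly_1:
  assumes "n \<noteq> 1"
  shows "poly (bernoulli_poly n) 1 = bernoulli_num n"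
proof -
  have "poly (bernoulli_poly n) 1 = (\<Sum>j\<le>n. fact n * fps_nth bern_fps (n - j) / fact j)"
    by (simp add: poly_altdef degree_bernoulli_poly coeff_bernoulli_poly)
  also have "\<dots> = (\<Sum>j=0..n. fact n * fps_nth bern_fps j / fact (n - j))"
    by (subst sum.atLeastAtMost_rev) (simp add: atLeast0AtMost)
  also have "\<dots> = fact n * fps_nth (bern_fps * fps_exp 1) n"
    by (simp add: fps_mult_nth sum_distrib_left)
  also have "bern_fps * fps_exp 1 = bern_fps + fps_X"
    using bern_fps_mult by (simp add: algebra_simps)
  finally show ?thesis
    using assms
    by (simp add: bernoulli_num_def poly_0_coeff_0 coeff_bernoulli_poly distrib_left)
qed

section \<open>Power sums\<close>

lemma power_sum_at_0: "poly (power_sum n) 0 = 0"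
  by (simp add: power_sum_def bernoulli_num_def)

lemma power_sum_at_1: "n > 0 \<Longrightarrow> poly (power_sum n) 1 = 0"
  by (simp add: power_sum_def poly_bernoulli_poly_1)

lemma power_sum_1: "power_sum 1 = [:0, - 1 / 2, 1 / 2:]"
proof (rule poly_eqI)
  fix j
  consider "j = 0" | "j = 1" | "j = 2" | "j > (2 :: nat)" by linarith
  then show "coeff (power_sum 1) j = coeff [:0, - 1 / 2, 1 / 2:] j"
    by cases
      (auto simp: power_sum_def bernoulli_num_def poly_0_coeff_0 coeff_bernoulli_poly
        bern_fps_nth_0 bern_fps_nth_1 coeff_pCons numeral_2_eq_2 split: nat.split)
qed

lemma pderiv_power_sum: "pderiv (power_sum n) = bernoulli_poly n"
  by (simp add: power_sum_def pderiv_smult pderiv_diff pderiv_bernoulli_poly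
      pderiv_pCons del: of_nat_Suc)

lemma bernoulli_poly_eq_power_sum:
  "bernoulli_poly (Suc n) = smult (of_nat (Suc n)) (power_sum n) + [:bernoulli_num (Suc n):]"
  by (simp add: power_sum_def del: of_nat_Suc)

lemma degree_power_sum: "degree (power_sum n) = Suc n"
  and lead_coeff_power_sum: "lead_coeff (power_sum n) = 1 / of_nat (Suc n)"
proof -
  have c: "coeff (power_sum n) (Suc n) = 1 / of_nat (Suc n)"
    by (simp add: power_sum_def lead_coeff_bernoulli_poly del: of_nat_Suc)
  have "coeff (power_sum n) j = 0" if "j > Suc n" for j
    using that by (cases j) (auto simp: power_sum_def coeff_bernoulli_poly)
  then show d: "degree (power_sum n) = Suc n"
    using c by (intro antisym degree_le le_degree) auto
  show "lead_coeff (power_sum n) = 1 / of_nat (Suc n)"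
    using c by (simp add: d)
qed

section \<open>The second x-derivative as an operator in y\<close>

definition faulhaber_op :: "rat poly \<Rightarrow> rat poly" where
  "faulhaber_op G = [:1 / 4, 2:] * pderiv (pderiv G) + pderiv G"

lemma pderiv_power_sum_1: "pderiv (power_sum 1) = [:- 1 / 2, 1:]"
  by (simp add: power_sum_1 pderiv_pCons del: One_nat_def)

text \<open>
  Chain rule for \<open>y = S\<^sub>1(x)\<close>: the identities \<open>y' = x - 1/2\<close>, \<open>y'\<^sup>2 = 2 y + 1/4\<close> and
  \<open>y'' = 1\<close> turn the second derivative in \<open>x\<close> into an operator in \<open>y\<close> alone.
\<close>
lemma pderiv_pderiv_pcompose_power_sum_1:
  "pderiv (pderiv (G \<circ>\<^sub>p power_sum 1)) = faulhaber_op G \<circ>\<^sub>p power_sum 1"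
proof -
  have "[:1 / 4, 2:] \<circ>\<^sub>p power_sum 1 = [:- 1 / 2, 1:] * [:- 1 / 2, 1:]"
    by (simp add: power_sum_1 pcompose_pCons del: One_nat_def)
  then show ?thesis
    by (simp add: faulhaber_op_def pderiv_pcompose pderiv_mult pcompose_add pcompose_mult
        pderiv_power_sum_1 pderiv_pCons mult_ac
        del: mult_pCons_left mult_pCons_right One_nat_def)
qed

text \<open>The factor 2k + 1 collects 2k from 2 y G'' and 1 from G'.\<close>

lemma coeff_faulhaber_op:
  "coeff (faulhaber_op G) k =
     of_nat (Suc k) * of_nat (2 * k + 1) * coeff G (Suc k)
     + of_nat (Suc k) * of_nat (Suc (Suc k)) / 4 * coeff G (Suc (Suc k))"
  by (cases k) (simp_all add: faulhaber_op_def coeff_pderiv field_simps)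

lemma faulhaber_op_add: "faulhaber_op (p + q) = faulhaber_op p + faulhaber_op q"
  and faulhaber_op_smult: "faulhaber_op (smult c p) = smult c (faulhaber_op p)"
  by (simp_all add: faulhaber_op_def pderiv_add pderiv_smult algebra_simps smult_add_right)

lemma faulhaber_op_0: "faulhaber_op 0 = 0"
  and faulhaber_op_const: "faulhaber_op [:c:] = 0"
  by (simp_all add: faulhaber_op_def pderiv_pCons)

text \<open>The operator is triangular: y^(d+2) goes to a y^(d+1) + b y^d with a nonzero, and the
  lower term is corrected by the induction hypothesis.\<close>

lemma monom_in_range_faulhaber_op: "\<exists>G. faulhaber_op G = monom 1 d"
proof (induction d)
  case 0
  have "faulhaber_op (monom 1 1) = monom 1 0"
    by (rule poly_eqI) (auto simp: coeff_faulhaber_op)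
  then show ?case by blast
next
  case (Suc d)
  then obtain G where G: "faulhaber_op G = monom 1 d" by blast
  define a b :: rat
    where "a = of_nat (d + 2) * of_nat (2 * d + 3)" and "b = of_nat (d + 2) * of_nat (d + 1) / 4"
  have "a \<noteq> 0"
    unfolding a_def mult_eq_0_iff of_nat_eq_0_iff by simp
  moreover have "faulhaber_op (monom 1 (d + 2)) = smult a (monom 1 (Suc d)) + smult b (monom 1 d)"
    by (rule poly_eqI) (auto simp: coeff_faulhaber_op a_def b_def algebra_simps)
  ultimately have "faulhaber_op (smult (1 / a) (monom 1 (d + 2) + smult (- b) G)) = monom 1 (Suc d)"
    unfolding faulhaber_op_add faulhaber_op_smult G by simp
  then show ?case by blast
qed

lemma faulhaber_op_sum: "faulhaber_op (sum f A) = (\<Sum>i\<in>A. faulhaber_op (f i))"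
  by (induction A rule: infinite_finite_induct) (simp_all add: faulhaber_op_0 faulhaber_op_add)

text \<open>Monomials suffice by linearity. Constants lie in the kernel, which leaves the value at 0
  free to be normalised.\<close>

lemma faulhaber_op_surj: "\<exists>G. faulhaber_op G = p \<and> poly G 0 = 0"
proof -
  obtain M where M: "faulhaber_op (M d) = monom 1 d" for d
    using monom_in_range_faulhaber_op by metis
  define H where "H = (\<Sum>i\<le>degree p. smult (coeff p i) (M i))"
  have "faulhaber_op H = p"
    by (simp add: H_def faulhaber_op_sum faulhaber_op_smult M smult_monom poly_as_sum_of_monoms)
  then have "faulhaber_op (H + [:- poly H 0:]) = p"
    by (simp only: faulhaber_op_add faulhaber_op_const add_0_right)
  then show ?thesis by (intro exI[of _ "H + [:- poly H 0:]"]) simp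
qed

section \<open>Odd power sums as polynomials in S_1\<close>

lemma poly_eq_0_if_pderiv_pderiv_eq_0:
  fixes p :: "'a :: field_char_0 poly"
  assumes "pderiv (pderiv p) = 0" "poly p a = 0" "poly p b = 0" "a \<noteq> b"
  shows "p = 0"
proof (rule ccontr)
  assume "p \<noteq> 0"
  have "degree p \<le> 1"
    using assms(1) by (simp add: pderiv_eq_0_iff degree_pderiv)
  moreover have "card {a, b} \<le> degree p"
    using \<open>p \<noteq> 0\<close> assms(2,3)
    by (intro order_trans[OF card_mono card_poly_roots_bound] poly_roots_finite) auto
  ultimately show False using \<open>a \<noteq> b\<close> by simp
qed

text \<open>The constant appears because S_n is the Bernoulli polynomial shifted to vanish at
  0.\<close>

lemma pderiv_pderiv_power_sum:
  "pderiv (pderiv (power_sum (n + 2))) =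
     smult (of_nat ((n + 2) * (n + 1))) (power_sum n)
     + [:of_nat (n + 2) * bernoulli_num (n + 1):]"
proof -
  have "pderiv (pderiv (power_sum (n + 2))) = smult (of_nat (n + 2)) (bernoulli_poly (n + 1))"
    using pderiv_bernoulli_poly[of "n + 1"] by (simp add: pderiv_power_sum)
  then show ?thesis
    using bernoulli_poly_eq_power_sum[of n] by (simp add: smult_add_right algebra_simps)
qed

lemma power_sum_odd_pcompose:
  "odd n \<Longrightarrow> \<exists>G. power_sum n = G \<circ>\<^sub>p power_sum 1 \<and> poly G 0 = 0"
proof (induction n rule: nat_induct2)
  case 0
  then show ?case by simp
next
  case 1
  show ?case by (intro exI[of _ polyvar]) (simp add: pcompose_pCons)
next
  case (step n)
  then obtain H where H: "power_sum n = H \<circ>\<^sub>p power_sum 1" by auto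
  obtain G where G: "faulhaber_op G =
      smult (of_nat ((n + 2) * (n + 1))) H + [:of_nat (n + 2) * bernoulli_num (n + 1):]"
    and G0: "poly G 0 = 0"
    using faulhaber_op_surj by blast
  \<comment> \<open>The second derivatives agree by the choice of G. Both polynomials vanish at 0
    and 1, since S_1 does and G(0) = 0.\<close>
  have "power_sum (n + 2) - G \<circ>\<^sub>p power_sum 1 = 0"
  proof (rule poly_eq_0_if_pderiv_pderiv_eq_0[where a = 0 and b = 1])
    show "pderiv (pderiv (power_sum (n + 2) - G \<circ>\<^sub>p power_sum 1)) = 0"
      unfolding pderiv_diff pderiv_pderiv_power_sum pderiv_pderiv_pcompose_power_sum_1 G H
      by (simp add: pcompose_add pcompose_smult)
  qed (simp_all add: poly_pcompose power_sum_at_0 power_sum_at_1 G0 del: One_nat_def)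
  then show ?case using G0 by auto
qed

text \<open>
  The \<open>y\<close>-derivative of \<open>G\<close> vanishes at \<open>0\<close> because \<open>S\<^sub>n'\<close> takes the same value at
  \<open>x = 0\<close> and \<open>x = 1\<close>, whereas \<open>S\<^sub>1'\<close> takes the values \<open>-1/2\<close> and \<open>1/2\<close>.
\<close>
lemma power_sum_odd_pcompose_square:
  assumes "odd n" "n \<ge> 3"
  shows "\<exists>F. power_sum n = (power_sum 1)\<^sup>2 * (F \<circ>\<^sub>p power_sum 1)"
proof -
  obtain G where G: "power_sum n = G \<circ>\<^sub>p power_sum 1" "poly G 0 = 0"
    using power_sum_odd_pcompose assms by blast
  have der: "bernoulli_poly n = (pderiv G \<circ>\<^sub>p power_sum 1) * [:- 1 / 2, 1:]"
    using arg_cong[OF G(1), of pderiv] pderiv_power_sum_1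
    by (simp only: pderiv_power_sum pderiv_pcompose)
  have "poly (bernoulli_poly n) 0 = poly (bernoulli_poly n) 1"
    using assms poly_bernoulli_poly_1[of n] by (simp add: bernoulli_num_def)
  then have "poly (pderiv G) 0 = 0"
    by (simp add: der poly_pcompose power_sum_at_0 power_sum_at_1 del: One_nat_def)
  then have c: "coeff G 0 = 0" "coeff G 1 = 0"
    using G(2) by (simp_all add: poly_0_coeff_0 coeff_pderiv)
  obtain a b F where "G = pCons a (pCons b F)"
    by (metis pCons_cases)
  with c have "G = polyvar\<^sup>2 * F" by (simp add: power2_eq_square)
  then have "power_sum n = (power_sum 1)\<^sup>2 * (F \<circ>\<^sub>p power_sum 1)"
    by (simp add: G(1) pcompose_mult pcompose_pCons power2_eq_square)
  then show ?thesis by blast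
qed

section \<open>Uniqueness and degree of the Faulhaber polynomials\<close>

lemma pcompose_cancel_right:
  fixes p q r :: "'a :: idom poly"
  assumes "degree r > 0"
  shows "p \<circ>\<^sub>p r = q \<circ>\<^sub>p r \<longleftrightarrow> p = q"
  using pcompose_eq_0_iff[OF assms, of "p - q"] by (simp add: pcompose_diff)

lemma pcompose_power_sum_1_inject:
  "p \<circ>\<^sub>p power_sum 1 = q \<circ>\<^sub>p power_sum 1 \<longleftrightarrow> p = q"
  by (rule pcompose_cancel_right) (simp add: degree_power_sum del: One_nat_def)

lemma power_sum_1_neq_0: "power_sum 1 \<noteq> 0"
  by (simp add: power_sum_1 del: One_nat_def)

text \<open>Degrees in x give n + 1 = 4 + 2 deg F, so any such factor meets the degree condition in
  \<open>faulhaber\<close>.\<close>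

lemma degree_faulhaber_factor:
  assumes "odd n" "n \<ge> 3" "power_sum n = (power_sum 1)\<^sup>2 * (F \<circ>\<^sub>p power_sum 1)"
  shows "degree F = faulhaber_degree n"
proof -
  have "F \<circ>\<^sub>p power_sum 1 \<noteq> 0"
    using assms(3) degree_power_sum[of n] by auto
  then have "Suc n = 4 + 2 * degree F"
    using arg_cong[OF assms(3), of degree] power_sum_1_neq_0
    by (simp add: degree_mult_eq degree_power_eq degree_pcompose degree_power_sum del: One_nat_def)
  then show ?thesis by (simp add: faulhaber_degree_def)
qed

text \<open>This justifies the definite description: existence is known, and uniqueness follows by
  cancelling S_1^2 and then the composition with S_1.\<close>

lemma
  assumes "odd n" "n \<ge> 3"
  shows power_sum_faulhaber:
      "power_sum n = (power_sum 1)\<^sup>2 * (faulhaber n \<circ>\<^sub>p power_sum 1)"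
    and degree_faulhaber: "degree (faulhaber n) = faulhaber_degree n"
proof -
  obtain F where F: "power_sum n = (power_sum 1)\<^sup>2 * (F \<circ>\<^sub>p power_sum 1)"
    using power_sum_odd_pcompose_square assms by blast
  have "faulhaber n = F"
    unfolding faulhaber_def
  proof (rule the_equality)
    show "degree F = faulhaber_degree n \<and>
        (if even n then power_sum n = power_sum 2 * (F \<circ>\<^sub>p power_sum 1)
         else power_sum n = (power_sum 1)\<^sup>2 * (F \<circ>\<^sub>p power_sum 1))"
      using assms F degree_faulhaber_factor by simp
  next
    fix H
    assume "degree H = faulhaber_degree n \<and>
        (if even n then power_sum n = power_sum 2 * (H \<circ>\<^sub>p power_sum 1)
         else power_sum n = (power_sum 1)\<^sup>2 * (H \<circ>\<^sub>p power_sum 1))"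
    then have "(power_sum 1)\<^sup>2 * (H \<circ>\<^sub>p power_sum 1) = (power_sum 1)\<^sup>2 * (F \<circ>\<^sub>p power_sum 1)"
      using assms F by metis
    then show "H = F"
      using power_sum_1_neq_0 pcompose_power_sum_1_inject by (metis mult_cancel_left power_eq_0_iff)
  qed
  with F show "power_sum n = (power_sum 1)\<^sup>2 * (faulhaber n \<circ>\<^sub>p power_sum 1)" by simp
  then show "degree (faulhaber n) = faulhaber_degree n"
    using degree_faulhaber_factor assms by blast
qed

section \<open>Leading coefficient and recurrences\<close>

lemma lead_coeff_faulhaber:
  assumes "odd n" "n \<ge> 3"
  shows "lead_coeff (faulhaber n) = 2 ^ ((n + 1) div 2) / of_nat (n + 1)"
proof -
  have "lead_coeff (power_sum n) =
      (lead_coeff (power_sum 1))\<^sup>2 *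
      (lead_coeff (faulhaber n) * lead_coeff (power_sum 1) ^ faulhaber_degree n)"
    unfolding power_sum_faulhaber[OF assms]
    by (simp add: lead_coeff_mult lead_coeff_power lead_coeff_comp degree_power_sum
        degree_faulhaber[OF assms] del: One_nat_def)
  \<comment> \<open>S_1 has leading coefficient 1/2; its square contributes two factors, the
    composition one per degree of F_n.\<close>
  then have "1 / of_nat (n + 1) = lead_coeff (faulhaber n) * (1 / 2) ^ (2 + faulhaber_degree n)"
    by (simp add: lead_coeff_power_sum power_add mult_ac power2_eq_square)
  moreover have "2 + faulhaber_degree n = (n + 1) div 2"
    using assms by (auto simp: faulhaber_degree_def elim!: oddE)
  ultimately have "1 / of_nat (n + 1) = lead_coeff (faulhaber n) * (1 / 2) ^ ((n + 1) div 2)"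
    by metis
  then show ?thesis
    by (simp add: power_one_over field_simps)
qed

text \<open>The second derivative of S_n is computed in two ways, and the composition with S_1 is
  cancelled.\<close>

lemma faulhaber_op_faulhaber:
  assumes "odd n" "n \<ge> 5"
  shows "faulhaber_op (polyvar\<^sup>2 * faulhaber n) =
    smult (of_nat (n * (n - 1))) (polyvar\<^sup>2 * faulhaber (n - 2))
    + [:of_nat n * bernoulli_num (n - 1):]"
proof -
  have ps: "power_sum m = (polyvar\<^sup>2 * faulhaber m) \<circ>\<^sub>p power_sum 1" if "odd m" "m \<ge> 3" for m
    using power_sum_faulhaber[OF that]
    by (simp add: pcompose_mult pcompose_pCons power2_eq_square)
  have "odd (n - 2)" "n - 2 \<ge> 3" "n - 2 + 2 = n" "n - 2 + 1 = n - 1"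
    using assms by auto
  then have "faulhaber_op (polyvar\<^sup>2 * faulhaber n) \<circ>\<^sub>p power_sum 1 =
      (smult (of_nat (n * (n - 1))) (polyvar\<^sup>2 * faulhaber (n - 2))
       + [:of_nat n * bernoulli_num (n - 1):]) \<circ>\<^sub>p power_sum 1"
    using pderiv_pderiv_power_sum[of "n - 2"] assms
    by (simp only: pderiv_pderiv_pcompose_power_sum_1[symmetric] ps[symmetric]
        pcompose_add pcompose_smult pcompose_const)
      (simp add: ps pcompose_smult)
  then show ?thesis by (simp only: pcompose_power_sum_1_inject)
qed

lemma coeff_polyvar_square_mult: "coeff (polyvar\<^sup>2 * p) k = (if k < 2 then 0 else coeff p (k - 2))"
  by (cases k; cases "k - 1") (auto simp: power2_eq_square coeff_pCons)

lemma coeff_theta: "coeff (theta \<alpha> p) k = (1 + \<alpha> * of_nat k) * coeff p k"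
  by (cases k) (auto simp: theta_def coeff_pderiv algebra_simps)

text \<open>This is the coefficient of y^(k+2), which the additive constant does not reach.\<close>

lemma faulhaber_coeff_recurrence:
  assumes "odd n" "n \<ge> 5"
  shows "of_nat (n * (n - 1)) * faulhaber_coeff (n - 2) k =
    of_nat (k + 3) * of_nat (2 * k + 5) * faulhaber_coeff n (k + 1)
    + of_nat (k + 3) * of_nat (k + 4) / 4 * faulhaber_coeff n (k + 2)"
  using arg_cong[OF faulhaber_op_faulhaber[OF assms], of "\<lambda>p. coeff p (k + 2)"]
  unfolding coeff_faulhaber_op coeff_add coeff_smult coeff_polyvar_square_mult
  by (simp add: coeff_pCons algebra_simps)

text \<open>At y^1 neither y^2 F_(n-2) nor the constant contributes.\<close>

lemma faulhaber_coeff_0_1: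
  assumes "odd n" "n \<ge> 5"
  shows "6 * faulhaber_coeff n 0 + 3 / 2 * faulhaber_coeff n 1 = 0"
  using arg_cong[OF faulhaber_op_faulhaber[OF assms], of "\<lambda>p. coeff p 1"]
  unfolding coeff_faulhaber_op coeff_add coeff_smult coeff_polyvar_square_mult
  by (simp add: coeff_pCons numeral_eq_Suc)

lemma of_nat_choose_two: "of_nat (m choose 2) = (of_nat m * (of_nat m - 1) / 2 :: 'a :: field_char_0)"
  by (simp add: binomial_gbinomial gbinomial_pochhammer' numeral_2_eq_2 pochhammer_Suc algebra_simps)

theorem theorem5p3:
  shows "(\<forall>n\<ge>5. odd n \<longrightarrow>
            smult (of_nat (n * (n - 1))) (polyvar\<^sup>2 * faulhaber (n - 2)) =
              smult (1/2) ((theta (1/2) \<circ> theta 1) (faulhaber n - [:poly (faulhaber n) 0:]))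
              + 6 * polyvar * (theta (1/2) \<circ> theta (2/3)) (faulhaber n))
       \<and> (\<forall>n\<ge>5. odd n \<longrightarrow>
            (\<forall>k. of_nat (n choose 2) * faulhaber_coeff (n - 2) k =
               1/2 * of_nat ((2 * (k + 3)) choose 2) * faulhaber_coeff n (k + 1)
               + 1/4 * of_nat ((k + 4) choose 2) * faulhaber_coeff n (k + 2)))
       \<and> (\<forall>n\<ge>3. odd n \<longrightarrow>
            lead_coeff (faulhaber n) = faulhaber_coeff n (faulhaber_degree n) \<and>
            faulhaber_coeff n (faulhaber_degree n) = 2 ^ ((n + 1) div 2) / of_nat (n + 1))"
proof (intro conjI allI impI)
  fix n :: nat
  assume n: "n \<ge> 5" "odd n"
  show "smult (of_nat (n * (n - 1))) (polyvar\<^sup>2 * faulhaber (n - 2)) =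
      smult (1/2) ((theta (1/2) \<circ> theta 1) (faulhaber n - [:poly (faulhaber n) 0:]))
      + 6 * polyvar * (theta (1/2) \<circ> theta (2/3)) (faulhaber n)" (is "?l = ?r")
  proof (rule poly_eqI)
    fix j
    have six: "6 * polyvar * p = pCons 0 (smult 6 p)" for p :: "rat poly"
      by (simp add: numeral_poly)
    \<comment> \<open>Subtracting F_n(0) makes both sides vanish at j = 0. The other cases are the
      two coefficient identities, as each \<open>theta\<close> scales y^i by a scalar.\<close>
    consider "j = 0" | "j = 1" | k :: nat where "j = k + 2"
      by (metis One_nat_def add_2_eq_Suc' not0_implies_Suc)
    then show "coeff ?l j = coeff ?r j"
    proof cases
      case 1
      then show ?thesis
        by (simp add: coeff_polyvar_square_mult six coeff_theta poly_0_coeff_0)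
    next
      case 2
      then show ?thesis
        using faulhaber_coeff_0_1[OF n(2,1)]
        unfolding coeff_add coeff_smult coeff_polyvar_square_mult six
        by (simp add: coeff_theta coeff_pCons)
    next
      case 3
      then show ?thesis
        using faulhaber_coeff_recurrence[OF n(2,1), of k]
        unfolding coeff_add coeff_smult coeff_polyvar_square_mult six
        by (simp add: coeff_theta coeff_pCons field_simps)
    qed
  qed
next
  fix n k :: nat
  assume n: "n \<ge> 5" "odd n"
  show "of_nat (n choose 2) * faulhaber_coeff (n - 2) k =
      1/2 * of_nat ((2 * (k + 3)) choose 2) * faulhaber_coeff n (k + 1)
      + 1/4 * of_nat ((k + 4) choose 2) * faulhaber_coeff n (k + 2)"
    \<comment> \<open>Half of the recurrence: 2(k+3) choose 2 equals (k+3)(2k+5).\<close>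
    using faulhaber_coeff_recurrence[OF n(2,1), of k] n
    unfolding of_nat_choose_two by (simp add: of_nat_diff field_simps)
next
  fix n :: nat
  assume n: "n \<ge> 3" "odd n"
  then show "lead_coeff (faulhaber n) = faulhaber_coeff n (faulhaber_degree n)"
    by (simp add: degree_faulhaber)
  then show "faulhaber_coeff n (faulhaber_degree n) = 2 ^ ((n + 1) div 2) / of_nat (n + 1)"
    using lead_coeff_faulhaber n by metis
qed

end
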